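(* Let $H$ be a Hopf algebra over $\Bbbk$ which is generated as an algebra by a simple subcoalgebra $D$ of dimension $4$, and let $\pi:H\to H_4$ be a surjective Hopf algebra map onto the Sweedler Hopf algebra $H_4$. Then $\dim {}^{\mathrm{co}\,\pi}D\geq 2$ or $\dim D^{\mathrm{co}\,\pi}\geq 2$.
   Context: $\Bbbk$ is an algebraically closed field of characteristic $0$, Hopf algebras finite dimensional. The Sweedler Hopf algebra $H_4$ is generated as an algebra by $g,x$ with $g^2=1$, $x^2=0$, $gx=-xg$, where $g$ is grouplike and $\Delta(x)=x\otimes 1+g\otimes x$. For a subcoalgebra $D$ of $H$, $D^{\mathrm{co}\,\pi}=\{d\in D:(\mathrm{id}\otimes\pi)\Delta(d)=d\otimes 1\}$ and ${}^{\mathrm{co}\,\pi}D=\{d\in D:(\pi\otimes\mathrm{id})\Delta(d)=1\otimes d\}$. *)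

theory Defs
  imports "HOL-Analysis.Analysis" "HOL-Computational_Algebra.Polynomial"
begin

section \<open>Finite-dimensional Hopf algebras via structure constants\<close>

text \<open>A finite-dimensional algebra/coalgebra H over a field 'k is given by a basis indexed
by a finite type 'b; elements are vectors of type 'k^'b, and H tensor H is identified with
'k^('b \<times> 'b).  Structure constants:
  e_i e_j = sum_l hmul i j l e_l;   1 = sum_l hunit l e_l;
  Delta(e_l) = sum_{i,j} hcomul l i j e_i (x) e_j;  eps(e_l) = hcounit l;
  S(e_i) = sum_l hantip i l e_l.\<close>

record ('b, 'k) hopf_sc =
  hmul :: "'b \<Rightarrow> 'b \<Rightarrow> 'b \<Rightarrow> 'k"
  hunit :: "'b \<Rightarrow> 'k"
  hcomul :: "'b \<Rightarrow> 'b \<Rightarrow> 'b \<Rightarrow> 'k"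
  hcounit :: "'b \<Rightarrow> 'k"
  hantip :: "'b \<Rightarrow> 'b \<Rightarrow> 'k"

definition kd :: "'b \<Rightarrow> 'b \<Rightarrow> 'k::ring_1" where
  "kd i j = (if i = j then 1 else 0)"

definition is_hopf :: "('b::finite, 'k::field) hopf_sc \<Rightarrow> bool" where
  "is_hopf A \<longleftrightarrow>
     (let m = hmul A; u = hunit A; c = hcomul A; e = hcounit A; S = hantip A in
      \<comment> \<open>associativity\<close>
      (\<forall>i j k l. (\<Sum>p\<in>UNIV. m i j p * m p k l) = (\<Sum>p\<in>UNIV. m j k p * m i p l)) \<and>
      \<comment> \<open>unit\<close>
      (\<forall>i l. (\<Sum>p\<in>UNIV. u p * m p i l) = kd i l \<and> (\<Sum>p\<in>UNIV. u p * m i p l) = kd i l) \<and>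
      \<comment> \<open>coassociativity\<close>
      (\<forall>l i j k. (\<Sum>p\<in>UNIV. c l p k * c p i j) = (\<Sum>p\<in>UNIV. c l i p * c p j k)) \<and>
      \<comment> \<open>counit\<close>
      (\<forall>l j. (\<Sum>p\<in>UNIV. e p * c l p j) = kd l j \<and> (\<Sum>p\<in>UNIV. e p * c l j p) = kd l j) \<and>
      \<comment> \<open>comultiplication is an algebra map\<close>
      (\<forall>i j a b. (\<Sum>l\<in>UNIV. m i j l * c l a b) =
          (\<Sum>p\<in>UNIV. \<Sum>q\<in>UNIV. \<Sum>r\<in>UNIV. \<Sum>s\<in>UNIV. c i p q * c j r s * m p r a * m q s b)) \<and>
      (\<forall>a b. (\<Sum>l\<in>UNIV. u l * c l a b) = u a * u b) \<and>
      \<comment> \<open>counit is an algebra map\<close>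
      (\<forall>i j. (\<Sum>l\<in>UNIV. m i j l * e l) = e i * e j) \<and>
      (\<Sum>l\<in>UNIV. u l * e l) = 1 \<and>
      \<comment> \<open>antipode\<close>
      (\<forall>l a. (\<Sum>p\<in>UNIV. \<Sum>q\<in>UNIV. \<Sum>r\<in>UNIV. c l p q * S p r * m r q a) = e l * u a) \<and>
      (\<forall>l a. (\<Sum>p\<in>UNIV. \<Sum>q\<in>UNIV. \<Sum>r\<in>UNIV. c l p q * S q r * m p r a) = e l * u a))"

subsection \<open>Element-level operations\<close>

definition hmulv :: "('b::finite, 'k::field) hopf_sc \<Rightarrow> 'k^'b \<Rightarrow> 'k^'b \<Rightarrow> 'k^'b" where
  "hmulv A x y = (\<chi> l. \<Sum>i\<in>UNIV. \<Sum>j\<in>UNIV. x$i * y$j * hmul A i j l)"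

definition honev :: "('b::finite, 'k::field) hopf_sc \<Rightarrow> 'k^'b" where
  "honev A = (\<chi> l. hunit A l)"

definition hcomulv :: "('b::finite, 'k::field) hopf_sc \<Rightarrow> 'k^'b \<Rightarrow> 'k^('b \<times> 'b)" where
  "hcomulv A x = (\<chi> p. \<Sum>l\<in>UNIV. x$l * hcomul A l (fst p) (snd p))"

definition hcounitv :: "('b::finite, 'k::field) hopf_sc \<Rightarrow> 'k^'b \<Rightarrow> 'k" where
  "hcounitv A x = (\<Sum>l\<in>UNIV. x$l * hcounit A l)"

definition hantipv :: "('b::finite, 'k::field) hopf_sc \<Rightarrow> 'k^'b \<Rightarrow> 'k^'b" where
  "hantipv A x = (\<chi> l. \<Sum>i\<in>UNIV. x$i * hantip A i l)"

text \<open>Simple tensors u (x) v and the tensor product f (x) g of linear maps.\<close>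

definition tens :: "'k::field^'a::finite \<Rightarrow> 'k^'b::finite \<Rightarrow> 'k^('a \<times> 'b)" where
  "tens u v = (\<chi> p. u$(fst p) * v$(snd p))"

definition tmap :: "('k::field^'a::finite \<Rightarrow> 'k^'c::finite) \<Rightarrow> ('k^'b::finite \<Rightarrow> 'k^'d::finite)
     \<Rightarrow> 'k^('a \<times> 'b) \<Rightarrow> 'k^('c \<times> 'd)" where
  "tmap f g t = (\<Sum>i\<in>UNIV. \<Sum>j\<in>UNIV. t$(i,j) *s tens (f (axis i 1)) (g (axis j 1)))"

text \<open>Tensor product U (x) V of subspaces, as a subspace of H (x) H.\<close>
definition tens_sub :: "('k::field^'a::finite) set \<Rightarrow> ('k^'b::finite) set \<Rightarrow> ('k^('a \<times> 'b)) set" where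
  "tens_sub U V = vec.span {tens u v | u v. u \<in> U \<and> v \<in> V}"

subsection \<open>Subcoalgebras, subalgebras, Hopf maps, coinvariants\<close>

definition subcoalg :: "('b::finite, 'k::field) hopf_sc \<Rightarrow> ('k^'b) set \<Rightarrow> bool" where
  "subcoalg A D \<longleftrightarrow> vec.subspace D \<and> (\<forall>d\<in>D. hcomulv A d \<in> tens_sub D D)"

definition simple_subcoalg :: "('b::finite, 'k::field) hopf_sc \<Rightarrow> ('k^'b) set \<Rightarrow> bool" where
  "simple_subcoalg A D \<longleftrightarrow> subcoalg A D \<and> D \<noteq> {0} \<and>
     (\<forall>E. subcoalg A E \<and> E \<subseteq> D \<longrightarrow> E = {0} \<or> E = D)"

definition subalg :: "('b::finite, 'k::field) hopf_sc \<Rightarrow> ('k^'b) set \<Rightarrow> bool" where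
  "subalg A S \<longleftrightarrow> vec.subspace S \<and> honev A \<in> S \<and> (\<forall>x\<in>S. \<forall>y\<in>S. hmulv A x y \<in> S)"

text \<open>H is generated as an algebra by D: the only subalgebra containing D is H.\<close>
definition generates_alg :: "('b::finite, 'k::field) hopf_sc \<Rightarrow> ('k^'b) set \<Rightarrow> bool" where
  "generates_alg A D \<longleftrightarrow> (\<forall>S. subalg A S \<and> D \<subseteq> S \<longrightarrow> S = UNIV)"

definition hopf_map :: "('b::finite, 'k::field) hopf_sc \<Rightarrow> ('c::finite, 'k) hopf_sc
     \<Rightarrow> ('k^'b \<Rightarrow> 'k^'c) \<Rightarrow> bool" where
  "hopf_map A B f \<longleftrightarrow> Vector_Spaces.linear (*s) (*s) f \<and>
     (\<forall>x y. f (hmulv A x y) = hmulv B (f x) (f y)) \<and> f (honev A) = honev B \<and>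
     (\<forall>x. tmap f f (hcomulv A x) = hcomulv B (f x)) \<and>
     (\<forall>x. hcounitv B (f x) = hcounitv A x) \<and>
     (\<forall>x. f (hantipv A x) = hantipv B (f x))"

text \<open>D^{co pi} and {}^{co pi}D.\<close>
definition right_coinv :: "('b::finite, 'k::field) hopf_sc \<Rightarrow> ('c::finite, 'k) hopf_sc
     \<Rightarrow> ('k^'b \<Rightarrow> 'k^'c) \<Rightarrow> ('k^'b) set \<Rightarrow> ('k^'b) set" where
  "right_coinv A B f D = {d \<in> D. tmap id f (hcomulv A d) = tens d (honev B)}"

definition left_coinv :: "('b::finite, 'k::field) hopf_sc \<Rightarrow> ('c::finite, 'k) hopf_sc
     \<Rightarrow> ('k^'b \<Rightarrow> 'k^'c) \<Rightarrow> ('k^'b) set \<Rightarrow> ('k^'b) set" where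
  "left_coinv A B f D = {d \<in> D. tmap f id (hcomulv A d) = tens (honev B) d}"

section \<open>The Sweedler Hopf algebra H4\<close>

text \<open>Basis 1, g, x, gx.\<close>
datatype sw = S1 | Sg | Sx | Sgx

lemma UNIV_sw: "(UNIV :: sw set) = {S1, Sg, Sx, Sgx}"
  using sw.exhaust by auto

instance sw :: finite
  by standard (simp add: UNIV_sw)

text \<open>Product of basis elements: (sign, basis element); sign 0 means the product is 0.\<close>
fun sw_prod :: "sw \<Rightarrow> sw \<Rightarrow> int \<times> sw" where
  "sw_prod S1 b = (1, b)"
| "sw_prod a S1 = (1, a)"
| "sw_prod Sg Sg = (1, S1)"
| "sw_prod Sg Sx = (1, Sgx)"
| "sw_prod Sg Sgx = (1, Sx)"
| "sw_prod Sx Sg = (-1, Sgx)"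
| "sw_prod Sx Sx = (0, S1)"
| "sw_prod Sx Sgx = (0, S1)"
| "sw_prod Sgx Sg = (-1, Sx)"
| "sw_prod Sgx Sx = (0, S1)"
| "sw_prod Sgx Sgx = (0, S1)"

fun sw_coterms :: "sw \<Rightarrow> (sw \<times> sw) set" where
  "sw_coterms S1 = {(S1, S1)}"
| "sw_coterms Sg = {(Sg, Sg)}"
| "sw_coterms Sx = {(Sx, S1), (Sg, Sx)}"
| "sw_coterms Sgx = {(Sgx, Sg), (S1, Sgx)}"

fun sw_antip :: "sw \<Rightarrow> int \<times> sw" where
  "sw_antip S1 = (1, S1)"
| "sw_antip Sg = (1, Sg)"
| "sw_antip Sx = (-1, Sgx)"
| "sw_antip Sgx = (1, Sx)"

definition sweedler :: "(sw, 'k::field) hopf_sc" where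
  "sweedler =
     \<lparr> hmul = (\<lambda>a b c. if snd (sw_prod a b) = c then of_int (fst (sw_prod a b)) else 0),
       hunit = (\<lambda>c. if c = S1 then 1 else 0),
       hcomul = (\<lambda>c a b. if (a, b) \<in> sw_coterms c then 1 else 0),
       hcounit = (\<lambda>c. if c = S1 \<or> c = Sg then 1 else 0),
       hantip = (\<lambda>a c. if snd (sw_antip a) = c then of_int (fst (sw_antip a)) else 0) \<rparr>"

definition alg_closed_field :: "'k::field itself \<Rightarrow> bool" where
  "alg_closed_field _ \<longleftrightarrow> (\<forall>p :: 'k poly. degree p > 0 \<longrightarrow> (\<exists>z. poly p z = 0))"

end

theory Submission imports Defs begin

text \<open>The dual algebra \<open>H\<^sup>*\<close> acts on \<open>H\<close> by the hit actions \<open>f \<rightharpoonup> h = h\<^sub>1 f(h\<^sub>2)\<close> and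
\<open>h \<leftharpoonup> f = f(h\<^sub>1) h\<^sub>2\<close>, and the subcoalgebras of \<open>H\<close> are exactly the subspaces stable
under both actions.  Dualising \<open>\<pi>\<close> gives elements \<open>e\<^sub>1, e\<^sub>g, e\<^sub>x, e\<^sub>g\<^sub>x\<close> of \<open>H\<^sup>*\<close> obeying the
multiplication table of \<open>H\<^sub>4\<^sup>*\<close>; \<open>e\<^sub>1, e\<^sub>g\<close> are orthogonal idempotents with sum \<open>\<epsilon>\<close>, and
they cut \<open>D\<close> into four blocks \<open>e\<^sub>s \<rightharpoonup> D \<leftharpoonup> e\<^sub>t\<close>.  All four blocks are nonzero, the
mixed ones because \<open>D\<close> is simple, so by \<open>dim D = 4\<close> each is a line.  Since \<open>D\<close> generates \<open>H\<close> and
\<open>\<pi>\<close> is onto, \<open>e\<^sub>x\<close> or \<open>e\<^sub>g\<^sub>x\<close> is nonzero on \<open>D\<close>.  If both were, \<open>e\<^sub>x\<close> would span the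
\<open>(g,1)\<close>-corner of \<open>D\<^sup>*\<close>, and then the elements of \<open>D\<close> killed by \<open>e\<^sub>g\<^sub>x\<close> after any two
hits would form a proper nonzero subcoalgebra.  So \<open>e\<^sub>x\<close> vanishes on \<open>D\<close>, and then
\<open>e\<^sub>1 \<rightharpoonup> D\<close> consists of right coinvariants and meets two blocks, or \<open>e\<^sub>g\<^sub>x\<close> vanishes
on \<open>D\<close> and symmetrically \<open>D \<leftharpoonup> e\<^sub>1\<close> consists of left coinvariants.\<close>

lemma sum_rotate3:
  "(\<Sum>a\<in>A. \<Sum>b\<in>B. \<Sum>c\<in>C. f a b c) = (\<Sum>b\<in>B. \<Sum>c\<in>C. \<Sum>a\<in>A. f a b c)"
proof -
  have "(\<Sum>a\<in>A. \<Sum>b\<in>B. \<Sum>c\<in>C. f a b c) = (\<Sum>b\<in>B. \<Sum>a\<in>A. \<Sum>c\<in>C. f a b c)"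
    by (rule sum.swap)
  also have "\<dots> = (\<Sum>b\<in>B. \<Sum>c\<in>C. \<Sum>a\<in>A. f a b c)"
    by (rule sum.cong[OF refl], rule sum.swap)
  finally show ?thesis .
qed

lemma sum_rotate4:
  "(\<Sum>a\<in>A. \<Sum>b\<in>B. \<Sum>c\<in>C. \<Sum>d\<in>D. f a b c d) = (\<Sum>b\<in>B. \<Sum>c\<in>C. \<Sum>d\<in>D. \<Sum>a\<in>A. f a b c d)"
proof -
  have "(\<Sum>a\<in>A. \<Sum>b\<in>B. \<Sum>c\<in>C. \<Sum>d\<in>D. f a b c d) = (\<Sum>b\<in>B. \<Sum>a\<in>A. \<Sum>c\<in>C. \<Sum>d\<in>D. f a b c d)"
    by (rule sum.swap)
  also have "\<dots> = (\<Sum>b\<in>B. \<Sum>c\<in>C. \<Sum>d\<in>D. \<Sum>a\<in>A. f a b c d)"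
    by (rule sum.cong[OF refl], rule sum_rotate3)
  finally show ?thesis .
qed

lemma sum_mult_kd [simp]:
  "(\<Sum>j\<in>UNIV. (x (j::'b::finite) :: 'k::ring_1) * kd l j) = x l"
  "(\<Sum>j\<in>UNIV. (x (j::'b::finite) :: 'k::ring_1) * kd j l) = x l"
  by (simp_all add: kd_def if_distrib[of "(*) _"] cong: if_cong)

lemma sum_axis_left [simp]: "(\<Sum>l\<in>UNIV. axis j (1::'k::ring_1) $ l * f l) = f j"
  by (simp add: axis_def if_distrib[of "\<lambda>x. x * _"] cong: if_cong)

lemma sum_axis_right [simp]: "(\<Sum>l\<in>UNIV. f l * axis j (1::'k::ring_1) $ l) = f j"
  by (simp add: axis_def if_distrib[of "(*) _"] cong: if_cong)

lemma sum_axis_index [simp]: "(\<Sum>l\<in>UNIV. axis l (1::'k::ring_1) $ i * f l) = f i"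
  by (simp add: axis_def if_distrib[of "\<lambda>x. x * _"] cong: if_cong)

definition pairing :: "'k::field^'b::finite \<Rightarrow> 'k^'b \<Rightarrow> 'k" where
  "pairing w h = (\<Sum>l\<in>UNIV. w$l * h$l)"

lemma pairing_add_right: "pairing w (x + y) = pairing w x + pairing w y"
  unfolding pairing_def by (simp add: algebra_simps sum.distrib)

lemma pairing_scale_left: "pairing (k *s w) x = k * pairing w x"
  unfolding pairing_def by (simp add: sum_distrib_left mult_ac)

lemma pairing_scale_right: "pairing w (k *s x) = k * pairing w x"
  unfolding pairing_def by (simp add: sum_distrib_left mult_ac)

lemma pairing_zero [simp]: "pairing 0 x = 0" "pairing w 0 = 0"
  unfolding pairing_def by simp_all

definition agree_on :: "('k::field^'b::finite) set \<Rightarrow> 'k^'b \<Rightarrow> 'k^'b \<Rightarrow> bool" where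
  "agree_on D w v \<longleftrightarrow> (\<forall>d\<in>D. pairing w d = pairing v d)"

lemma not_in_span_if_killed:
  assumes add: "\<And>x y. T (x + y) = T x + T y" and scale: "\<And>k x. T (k *s x) = k *s T x"
    and kill: "\<And>s. s \<in> S \<Longrightarrow> T s = 0" and "T x \<noteq> (0::'k::field^'n::finite)"
  shows "x \<notin> vec.span S"
proof
  assume "x \<in> vec.span S"
  then have "T x = 0"
  proof (induction rule: vec.span_induct_alt)
    case base
    have "T 0 = T ((0::'k) *s 0)" by simp
    also have "\<dots> = 0" by (simp only: scale) simp
    finally show ?case .
  next
    case (step c x y)
    then show ?case by (simp add: add scale kill)
  qed
  with \<open>T x \<noteq> 0\<close> show False by simp
qed

lemma independent_insert_card:
  assumes "vec.independent S" "finite S" "x \<notin> vec.span S"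
  shows "vec.independent (insert x S) \<and> card (insert x S) = Suc (card S)"
  using assms vec.independent_insertI vec.span_base by (metis card_insert_disjoint)

lemma independent_singleton_card:
  "x \<noteq> (0::'k::field^'n::finite) \<Longrightarrow> vec.independent {x} \<and> card {x} = 1"
  using independent_insert_card[of "{}" x] by (simp add: vec.span_empty)

lemma independent_pair_by_projection:
  assumes "\<And>x y. T (x + y) = T x + T y" "\<And>k x. T (k *s x) = k *s T x"
    and "T p = p" "T q = 0" "p \<noteq> 0" "q \<noteq> (0::'k::field^'n::finite)"
  shows "vec.independent {p, q} \<and> card {p, q} = 2"
proof -
  have "p \<notin> vec.span {q}"
    by (rule not_in_span_if_killed[of T]) (use assms in auto)
  then show ?thesis
    using independent_insert_card[of "{q}" p] independent_singleton_card[of q] assms by simp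
qed

lemma two_le_dim_if_independent_pair:
  assumes "vec.independent {p, q} \<and> card {p, q} = 2" "{p, q} \<subseteq> V"
  shows "2 \<le> vec.dim V"
  using assms vec.independent_card_le_dim by metis

locale sc_coalgebra =
  fixes A :: "('b::finite, 'k::field) hopf_sc"
  assumes coassoc: "\<And>l i j k. (\<Sum>p\<in>UNIV. hcomul A l p k * hcomul A p i j)
      = (\<Sum>p\<in>UNIV. hcomul A l i p * hcomul A p j k)"
    and counit_left: "\<And>l j. (\<Sum>p\<in>UNIV. hcounit A p * hcomul A l p j) = kd l j"
    and counit_right: "\<And>l j. (\<Sum>p\<in>UNIV. hcounit A p * hcomul A l j p) = kd l j"
begin

abbreviation "c \<equiv> hcomul A"

text \<open>Functionals on \<open>H\<close> are vectors acting through \<open>pairing\<close>.  Then \<open>lhit f h\<close>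
is \<open>f \<rightharpoonup> h = h\<^sub>1 f(h\<^sub>2)\<close> and \<open>rhit f h\<close> is \<open>h \<leftharpoonup> f = f(h\<^sub>1) h\<^sub>2\<close>.\<close>

definition convolution :: "'k^'b \<Rightarrow> 'k^'b \<Rightarrow> 'k^'b" (infixl "\<star>" 70) where
  "w \<star> v = (\<chi> l. \<Sum>i\<in>UNIV. \<Sum>j\<in>UNIV. c l i j * w$i * v$j)"

definition lhit :: "'k^'b \<Rightarrow> 'k^'b \<Rightarrow> 'k^'b" where
  "lhit w h = (\<chi> i. \<Sum>l\<in>UNIV. \<Sum>j\<in>UNIV. h$l * c l i j * w$j)"

definition rhit :: "'k^'b \<Rightarrow> 'k^'b \<Rightarrow> 'k^'b" where
  "rhit w h = (\<chi> j. \<Sum>l\<in>UNIV. \<Sum>i\<in>UNIV. h$l * c l i j * w$i)"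

definition counit_vec :: "'k^'b" where
  "counit_vec = (\<chi> l. hcounit A l)"

lemma lhit_lhit: "lhit w (lhit v h) = lhit (w \<star> v) h"
proof -
  have "lhit w (lhit v h) $ i = lhit (w \<star> v) h $ i" for i
  proof -
    have "lhit w (lhit v h) $ i
        = (\<Sum>i'\<in>UNIV. \<Sum>k\<in>UNIV. \<Sum>l\<in>UNIV. \<Sum>j\<in>UNIV. h$l * c l i' j * v$j * c i' i k * w$k)"
      unfolding lhit_def by (simp add: sum_distrib_left sum_distrib_right)
    also have "\<dots> = (\<Sum>k\<in>UNIV. \<Sum>l\<in>UNIV. \<Sum>j\<in>UNIV. \<Sum>i'\<in>UNIV. h$l * c l i' j * v$j * c i' i k * w$k)"
      by (rule sum_rotate4)
    also have "\<dots> = (\<Sum>l\<in>UNIV. \<Sum>j\<in>UNIV. \<Sum>k\<in>UNIV. \<Sum>i'\<in>UNIV. h$l * c l i' j * v$j * c i' i k * w$k)"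
      by (rule sum_rotate3)
    also have "\<dots> = (\<Sum>l\<in>UNIV. \<Sum>j\<in>UNIV. \<Sum>k\<in>UNIV. (h$l * v$j * w$k) * (\<Sum>p\<in>UNIV. c l p j * c p i k))"
      by (simp add: sum_distrib_left mult_ac)
    also have "\<dots> = (\<Sum>l\<in>UNIV. \<Sum>j\<in>UNIV. \<Sum>k\<in>UNIV. (h$l * v$j * w$k) * (\<Sum>p\<in>UNIV. c l i p * c p k j))"
      by (simp add: coassoc)
    also have "\<dots> = (\<Sum>l\<in>UNIV. \<Sum>j\<in>UNIV. \<Sum>k\<in>UNIV. \<Sum>p\<in>UNIV. h$l * c l i p * (c p k j * w$k * v$j))"
      by (simp add: sum_distrib_left mult_ac)
    also have "\<dots> = (\<Sum>l\<in>UNIV. \<Sum>p\<in>UNIV. \<Sum>k\<in>UNIV. \<Sum>j\<in>UNIV. h$l * c l i p * (c p k j * w$k * v$j))"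
      by (rule sum.cong[OF refl], subst sum.swap, rule sum_rotate3[symmetric])
    also have "\<dots> = lhit (w \<star> v) h $ i"
      unfolding lhit_def convolution_def by (simp add: sum_distrib_left)
    finally show ?thesis .
  qed
  then show ?thesis by (simp add: vec_eq_iff)
qed

lemma rhit_rhit: "rhit w (rhit v h) = rhit (v \<star> w) h"
proof -
  have "rhit w (rhit v h) $ j' = rhit (v \<star> w) h $ j'" for j'
  proof -
    have "rhit w (rhit v h) $ j'
        = (\<Sum>j\<in>UNIV. \<Sum>i'\<in>UNIV. \<Sum>l\<in>UNIV. \<Sum>i\<in>UNIV. h$l * c l i j * v$i * c j i' j' * w$i')"
      unfolding rhit_def by (simp add: sum_distrib_left sum_distrib_right)
    also have "\<dots> = (\<Sum>i'\<in>UNIV. \<Sum>l\<in>UNIV. \<Sum>i\<in>UNIV. \<Sum>j\<in>UNIV. h$l * c l i j * v$i * c j i' j' * w$i')"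
      by (rule sum_rotate4)
    also have "\<dots> = (\<Sum>l\<in>UNIV. \<Sum>i\<in>UNIV. \<Sum>i'\<in>UNIV. \<Sum>j\<in>UNIV. h$l * c l i j * v$i * c j i' j' * w$i')"
      by (rule sum_rotate3)
    also have "\<dots> = (\<Sum>l\<in>UNIV. \<Sum>i\<in>UNIV. \<Sum>i'\<in>UNIV. (h$l * v$i * w$i') * (\<Sum>p\<in>UNIV. c l i p * c p i' j'))"
      by (simp add: sum_distrib_left mult_ac)
    also have "\<dots> = (\<Sum>l\<in>UNIV. \<Sum>i\<in>UNIV. \<Sum>i'\<in>UNIV. (h$l * v$i * w$i') * (\<Sum>p\<in>UNIV. c l p j' * c p i i'))"
      by (simp add: coassoc)
    also have "\<dots> = (\<Sum>l\<in>UNIV. \<Sum>i\<in>UNIV. \<Sum>i'\<in>UNIV. \<Sum>p\<in>UNIV. h$l * c l p j' * (c p i i' * v$i * w$i'))"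
      by (simp add: sum_distrib_left mult_ac)
    also have "\<dots> = (\<Sum>l\<in>UNIV. \<Sum>p\<in>UNIV. \<Sum>i\<in>UNIV. \<Sum>i'\<in>UNIV. h$l * c l p j' * (c p i i' * v$i * w$i'))"
      by (rule sum.cong[OF refl], rule sum_rotate3[symmetric])
    also have "\<dots> = rhit (v \<star> w) h $ j'"
      unfolding rhit_def convolution_def by (simp add: sum_distrib_left)
    finally show ?thesis .
  qed
  then show ?thesis by (simp add: vec_eq_iff)
qed

lemma rhit_lhit_commute: "rhit w (lhit v h) = lhit v (rhit w h)"
proof -
  have "rhit w (lhit v h) $ j' = lhit v (rhit w h) $ j'" for j'
  proof -
    have "rhit w (lhit v h) $ j'
        = (\<Sum>i\<in>UNIV. \<Sum>i'\<in>UNIV. \<Sum>l\<in>UNIV. \<Sum>j\<in>UNIV. h$l * c l i j * v$j * c i i' j' * w$i')"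
      unfolding rhit_def lhit_def by (simp add: sum_distrib_left sum_distrib_right)
    also have "\<dots> = (\<Sum>i'\<in>UNIV. \<Sum>l\<in>UNIV. \<Sum>j\<in>UNIV. \<Sum>i\<in>UNIV. h$l * c l i j * v$j * c i i' j' * w$i')"
      by (rule sum_rotate4)
    also have "\<dots> = (\<Sum>l\<in>UNIV. \<Sum>j\<in>UNIV. \<Sum>i'\<in>UNIV. \<Sum>i\<in>UNIV. h$l * c l i j * v$j * c i i' j' * w$i')"
      by (rule sum_rotate3)
    also have "\<dots> = (\<Sum>l\<in>UNIV. \<Sum>j\<in>UNIV. \<Sum>i'\<in>UNIV. (h$l * v$j * w$i') * (\<Sum>p\<in>UNIV. c l p j * c p i' j'))"
      by (simp add: sum_distrib_left mult_ac)
    also have "\<dots> = (\<Sum>l\<in>UNIV. \<Sum>j\<in>UNIV. \<Sum>i'\<in>UNIV. (h$l * v$j * w$i') * (\<Sum>p\<in>UNIV. c l i' p * c p j' j))"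
      by (simp add: coassoc)
    also have "\<dots> = (\<Sum>l\<in>UNIV. \<Sum>j\<in>UNIV. \<Sum>i'\<in>UNIV. \<Sum>m\<in>UNIV. h$l * c l i' m * w$i' * c m j' j * v$j)"
      by (simp add: sum_distrib_left mult_ac)
    also have "\<dots> = (\<Sum>j\<in>UNIV. \<Sum>l\<in>UNIV. \<Sum>i'\<in>UNIV. \<Sum>m\<in>UNIV. h$l * c l i' m * w$i' * c m j' j * v$j)"
      by (rule sum.swap)
    also have "\<dots> = (\<Sum>m\<in>UNIV. \<Sum>j\<in>UNIV. \<Sum>l\<in>UNIV. \<Sum>i'\<in>UNIV. h$l * c l i' m * w$i' * c m j' j * v$j)"
      by (rule sum_rotate4[symmetric])
    also have "\<dots> = lhit v (rhit w h) $ j'"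
      unfolding rhit_def lhit_def by (simp add: sum_distrib_left sum_distrib_right)
    finally show ?thesis .
  qed
  then show ?thesis by (simp add: vec_eq_iff)
qed

lemma convolution_assoc: "(u \<star> v) \<star> w = u \<star> (v \<star> w)"
proof -
  have "((u \<star> v) \<star> w) $ l = (u \<star> (v \<star> w)) $ l" for l
  proof -
    have "((u \<star> v) \<star> w) $ l
        = (\<Sum>p\<in>UNIV. \<Sum>k\<in>UNIV. \<Sum>i\<in>UNIV. \<Sum>j\<in>UNIV. c l p k * (c p i j * u$i * v$j) * w$k)"
      unfolding convolution_def by (simp add: sum_distrib_left sum_distrib_right)
    also have "\<dots> = (\<Sum>k\<in>UNIV. \<Sum>i\<in>UNIV. \<Sum>j\<in>UNIV. \<Sum>p\<in>UNIV. c l p k * (c p i j * u$i * v$j) * w$k)"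
      by (rule sum_rotate4)
    also have "\<dots> = (\<Sum>i\<in>UNIV. \<Sum>j\<in>UNIV. \<Sum>k\<in>UNIV. \<Sum>p\<in>UNIV. c l p k * (c p i j * u$i * v$j) * w$k)"
      by (rule sum_rotate3)
    also have "\<dots> = (\<Sum>i\<in>UNIV. \<Sum>j\<in>UNIV. \<Sum>k\<in>UNIV. (u$i * v$j * w$k) * (\<Sum>p\<in>UNIV. c l p k * c p i j))"
      by (simp add: sum_distrib_left mult_ac)
    also have "\<dots> = (\<Sum>i\<in>UNIV. \<Sum>j\<in>UNIV. \<Sum>k\<in>UNIV. (u$i * v$j * w$k) * (\<Sum>p\<in>UNIV. c l i p * c p j k))"
      by (simp add: coassoc)
    also have "\<dots> = (\<Sum>i\<in>UNIV. \<Sum>j\<in>UNIV. \<Sum>k\<in>UNIV. \<Sum>p\<in>UNIV. c l i p * u$i * (c p j k * v$j * w$k))"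
      by (simp add: sum_distrib_left mult_ac)
    also have "\<dots> = (\<Sum>i\<in>UNIV. \<Sum>p\<in>UNIV. \<Sum>j\<in>UNIV. \<Sum>k\<in>UNIV. c l i p * u$i * (c p j k * v$j * w$k))"
      by (rule sum.cong[OF refl], rule sum_rotate3[symmetric])
    also have "\<dots> = (u \<star> (v \<star> w)) $ l"
      unfolding convolution_def by (simp add: sum_distrib_left)
    finally show ?thesis .
  qed
  then show ?thesis by (simp add: vec_eq_iff)
qed

lemma pairing_lhit: "pairing w (lhit v h) = pairing (w \<star> v) h"
proof -
  have "pairing w (lhit v h) = (\<Sum>i\<in>UNIV. \<Sum>l\<in>UNIV. \<Sum>j\<in>UNIV. w$i * (h$l * c l i j * v$j))"
    unfolding pairing_def lhit_def by (simp add: sum_distrib_left)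
  also have "\<dots> = (\<Sum>l\<in>UNIV. \<Sum>i\<in>UNIV. \<Sum>j\<in>UNIV. w$i * (h$l * c l i j * v$j))"
    by (rule sum.swap)
  also have "\<dots> = pairing (w \<star> v) h"
    unfolding pairing_def convolution_def by (simp add: sum_distrib_left sum_distrib_right mult_ac)
  finally show ?thesis .
qed

lemma pairing_rhit: "pairing w (rhit v h) = pairing (v \<star> w) h"
proof -
  have "pairing w (rhit v h) = (\<Sum>j\<in>UNIV. \<Sum>l\<in>UNIV. \<Sum>i\<in>UNIV. w$j * (h$l * c l i j * v$i))"
    unfolding pairing_def rhit_def by (simp add: sum_distrib_left)
  also have "\<dots> = (\<Sum>l\<in>UNIV. \<Sum>i\<in>UNIV. \<Sum>j\<in>UNIV. w$j * (h$l * c l i j * v$i))"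
    by (rule sum_rotate3)
  also have "\<dots> = pairing (v \<star> w) h"
    unfolding pairing_def convolution_def by (simp add: sum_distrib_left sum_distrib_right mult_ac)
  finally show ?thesis .
qed

lemma pairing_rhit_lhit: "pairing w (rhit s (lhit t h)) = pairing (s \<star> w \<star> t) h"
  by (simp add: pairing_lhit pairing_rhit)

lemma lhit_counit [simp]: "lhit counit_vec h = h"
proof -
  have "lhit counit_vec h $ i = (\<Sum>l\<in>UNIV. h$l * (\<Sum>j\<in>UNIV. hcounit A j * c l i j))" for i
    unfolding lhit_def counit_vec_def by (simp add: sum_distrib_left mult_ac)
  then show ?thesis by (simp add: vec_eq_iff counit_right)
qed

lemma rhit_counit [simp]: "rhit counit_vec h = h"
proof -
  have "rhit counit_vec h $ j = (\<Sum>l\<in>UNIV. h$l * (\<Sum>i\<in>UNIV. hcounit A i * c l i j))" for j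
    unfolding rhit_def counit_vec_def by (simp add: sum_distrib_left mult_ac)
  then show ?thesis by (simp add: vec_eq_iff counit_left)
qed

lemma pairing_counit_lhit: "pairing counit_vec (lhit w h) = pairing w h"
proof -
  have "pairing counit_vec (lhit w h) = pairing (counit_vec \<star> w) h"
    by (rule pairing_lhit)
  also have "counit_vec \<star> w = w"
  proof -
    have "(counit_vec \<star> w) $ l = (\<Sum>j\<in>UNIV. w$j * (\<Sum>i\<in>UNIV. hcounit A i * c l i j))" for l
      unfolding convolution_def counit_vec_def
      by (subst sum.swap) (simp add: sum_distrib_left mult_ac)
    then show ?thesis by (simp add: vec_eq_iff counit_left)
  qed
  finally show ?thesis .
qed

lemma lhit_add_left: "lhit (w + v) h = lhit w h + lhit v h"
  unfolding lhit_def by (simp add: vec_eq_iff algebra_simps sum.distrib)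
lemma lhit_add_right: "lhit w (x + y) = lhit w x + lhit w y"
  unfolding lhit_def by (simp add: vec_eq_iff algebra_simps sum.distrib)
lemma lhit_scale_right: "lhit w (k *s h) = k *s lhit w h"
  unfolding lhit_def by (simp add: vec_eq_iff sum_distrib_left mult_ac)
lemma rhit_add_right: "rhit w (x + y) = rhit w x + rhit w y"
  unfolding rhit_def by (simp add: vec_eq_iff algebra_simps sum.distrib)
lemma rhit_scale_right: "rhit w (k *s h) = k *s rhit w h"
  unfolding rhit_def by (simp add: vec_eq_iff sum_distrib_left mult_ac)
lemma hit_zero [simp]: "lhit 0 h = 0" "lhit w 0 = 0" "rhit 0 h = 0" "rhit w 0 = 0"
  unfolding lhit_def rhit_def by (simp_all add: vec_eq_iff)
lemma convolution_zero [simp]: "0 \<star> w = 0" "w \<star> 0 = 0"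
  unfolding convolution_def by (simp_all add: vec_eq_iff)
lemma convolution_scale_right: "w \<star> (k *s v) = k *s (w \<star> v)"
  unfolding convolution_def by (simp add: vec_eq_iff sum_distrib_left mult_ac)

definition contract_right :: "'k^'b \<Rightarrow> 'k^('b \<times> 'b) \<Rightarrow> 'k^'b" where
  "contract_right w t = (\<chi> i. \<Sum>j\<in>UNIV. t$(i,j) * w$j)"

definition contract_left :: "'k^'b \<Rightarrow> 'k^('b \<times> 'b) \<Rightarrow> 'k^'b" where
  "contract_left w t = (\<chi> j. \<Sum>i\<in>UNIV. t$(i,j) * w$i)"

lemma lhit_eq_contract: "lhit w h = contract_right w (hcomulv A h)"
proof -
  have "lhit w h $ i = (\<Sum>j\<in>UNIV. \<Sum>l\<in>UNIV. h$l * c l i j * w$j)" for i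
    unfolding lhit_def by simp (rule sum.swap)
  then show ?thesis
    by (simp add: vec_eq_iff contract_right_def hcomulv_def sum_distrib_right)
qed

lemma rhit_eq_contract: "rhit w h = contract_left w (hcomulv A h)"
proof -
  have "rhit w h $ j = (\<Sum>i\<in>UNIV. \<Sum>l\<in>UNIV. h$l * c l i j * w$i)" for j
    unfolding rhit_def by simp (rule sum.swap)
  then show ?thesis
    by (simp add: vec_eq_iff contract_left_def hcomulv_def sum_distrib_right)
qed

lemma contract_tens: "contract_right w (tens u v) = pairing w v *s u"
    "contract_left w (tens u v) = pairing w u *s v"
  unfolding contract_right_def contract_left_def tens_def pairing_def
  by (simp_all add: vec_eq_iff sum_distrib_left mult_ac)

lemma contract_linear: "contract_right w (k *s x + y) = k *s contract_right w x + contract_right w y"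
    "contract_left w (k *s x + y) = k *s contract_left w x + contract_left w y"
  unfolding contract_right_def contract_left_def
  by (simp_all add: vec_eq_iff sum_distrib_left sum.distrib algebra_simps)

lemma contract_zero [simp]: "contract_right w 0 = 0" "contract_left w 0 = 0"
  unfolding contract_right_def contract_left_def by (simp_all add: vec_eq_iff)

lemma contract_tens_sub:
  assumes "vec.subspace D" and "t \<in> tens_sub D D"
  shows "contract_right w t \<in> D \<and> contract_left w t \<in> D \<and>
    (agree_on D w w' \<longrightarrow> contract_right w t = contract_right w' t \<and> contract_left w t = contract_left w' t)"
  using \<open>t \<in> tens_sub D D\<close> unfolding tens_sub_def
proof (induction rule: vec.span_induct_alt)
  case base
  then show ?case using assms(1) by (simp add: vec.subspace_0)
next
  case (step k x y)
  then obtain u v where "x = tens u v" "u \<in> D" "v \<in> D" by blast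
  with step.IH assms(1) show ?case
    by (simp add: contract_linear contract_tens agree_on_def vec.subspace_add vec.subspace_scale)
qed

lemma subcoalg_lhit_mem: "subcoalg A D \<Longrightarrow> d \<in> D \<Longrightarrow> lhit w d \<in> D"
  unfolding subcoalg_def lhit_eq_contract using contract_tens_sub by blast

lemma subcoalg_rhit_mem: "subcoalg A D \<Longrightarrow> d \<in> D \<Longrightarrow> rhit w d \<in> D"
  unfolding subcoalg_def rhit_eq_contract using contract_tens_sub by blast

lemma subcoalg_lhit_cong: "subcoalg A D \<Longrightarrow> agree_on D w w' \<Longrightarrow> d \<in> D \<Longrightarrow> lhit w d = lhit w' d"
  unfolding subcoalg_def lhit_eq_contract using contract_tens_sub by blast

lemma subcoalg_rhit_cong: "subcoalg A D \<Longrightarrow> agree_on D w w' \<Longrightarrow> d \<in> D \<Longrightarrow> rhit w d = rhit w' d"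
  unfolding subcoalg_def rhit_eq_contract using contract_tens_sub by blast

lemma agree_on_convolution_right:
  assumes "subcoalg A D" "agree_on D z z'"
  shows "agree_on D (y \<star> z) (y \<star> z')"
  using subcoalg_lhit_cong[OF assms] by (simp add: agree_on_def pairing_lhit[symmetric])

text \<open>Column \<open>j\<close> of the matrix of \<open>\<Delta>(w)\<close> is \<open>e\<^sub>j\<^sup>* \<rightharpoonup> w \<in> W\<close> and its rows are \<open>w \<leftharpoonup> e\<^sub>i\<^sup>* \<in> W\<close>;
a projection \<open>P\<close> onto \<open>W\<close> fixes the rows, which writes \<open>\<Delta>(w) = \<Sum>\<^sub>j col\<^sub>j \<otimes> P(e\<^sub>j)\<close>.\<close>

lemma subcoalg_if_hit_stable:
  assumes W: "vec.subspace W"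
    and stable: "\<And>w v. w \<in> W \<Longrightarrow> lhit v w \<in> W \<and> rhit v w \<in> W"
  shows "subcoalg A W"
proof -
  obtain P where P: "P ` UNIV \<subseteq> W" "Vector_Spaces.linear (*s) (*s) P" "\<And>v. v \<in> W \<Longrightarrow> P v = v"
    using vec.linear_exists_left_inverse_on[of id W] W by (auto simp: vec.linear_id)
  have "hcomulv A w \<in> tens_sub W W" if w: "w \<in> W" for w
  proof -
    let ?t = "hcomulv A w"
    define col where "col j = lhit (axis j 1) w" for j
    define row where "row i = rhit (axis i 1) w" for i
    have col: "col j $ i = ?t $ (i,j)" for i j
      unfolding col_def lhit_def hcomulv_def axis_def by (simp add: if_distrib cong: if_cong)
    have row: "row i $ j = ?t $ (i,j)" for i j
      unfolding row_def rhit_def hcomulv_def axis_def by (simp add: if_distrib cong: if_cong)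
    have row_expand: "?t $ (i,k) = (\<Sum>j\<in>UNIV. ?t $ (i,j) * P (axis j 1) $ k)" for i k
    proof -
      have "row i = P (row i)"
        using P(3) stable[OF w] by (simp add: row_def)
      also have "\<dots> = P (\<Sum>j\<in>UNIV. (row i $ j) *s axis j 1)"
        by (simp only: basis_expansion)
      also have "\<dots> = (\<Sum>j\<in>UNIV. (row i $ j) *s P (axis j 1))"
        by (simp add: vec.linear_sum[OF P(2)] vec.linear_scale[OF P(2)])
      finally have "row i $ k = (\<Sum>j\<in>UNIV. (row i $ j) *s P (axis j 1)) $ k"
        by simp
      then show ?thesis by (simp add: row)
    qed
    have "?t = (\<Sum>j\<in>UNIV. tens (col j) (P (axis j 1)))"
      by (simp add: vec_eq_iff tens_def col row_expand[symmetric] split: prod.split)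
    also have "\<dots> \<in> tens_sub W W"
      unfolding tens_sub_def
      by (rule vec.span_sum, rule vec.span_base)
        (use stable[OF w] P(1) in \<open>auto simp: col_def image_subset_iff\<close>)
    finally show ?thesis .
  qed
  then show ?thesis using W by (simp add: subcoalg_def)
qed

end

locale sweedler_quotient = sc_coalgebra A for A :: "('b::finite, 'k::field) hopf_sc" +
  fixes \<pi> :: "'k^'b \<Rightarrow> 'k^sw"
  assumes hopf: "hopf_map A sweedler \<pi>"
begin

lemma linear_\<pi>: "Vector_Spaces.linear (*s) (*s) \<pi>"
  using hopf by (simp add: hopf_map_def)

text \<open>\<open>coord s\<close> is the pull-back along \<open>\<pi>\<close> of the dual basis vector \<open>s\<^sup>*\<close> of \<open>H\<^sub>4\<^sup>*\<close>.\<close>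

definition coord :: "sw \<Rightarrow> 'k^'b" where
  "coord s = (\<chi> j. \<pi> (axis j 1) $ s)"

lemma coord_nth [simp]: "coord s $ l = \<pi> (axis l 1) $ s"
  by (simp add: coord_def)

lemma pairing_coord: "pairing (coord s) h = \<pi> h $ s"
proof -
  have "\<pi> h = \<pi> (\<Sum>j\<in>UNIV. (h $ j) *s axis j 1)"
    by (simp add: basis_expansion)
  also have "\<dots> = (\<Sum>j\<in>UNIV. (h $ j) *s \<pi> (axis j 1))"
    by (simp add: vec.linear_sum[OF linear_\<pi>] vec.linear_scale[OF linear_\<pi>])
  finally show ?thesis by (simp add: pairing_def coord_def mult.commute)
qed

lemma convolution_coord:
  "coord s \<star> coord t = (\<chi> l. \<Sum>m\<in>UNIV. \<pi> (axis l 1) $ m * hcomul sweedler m s t)"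
proof -
  have "(coord s \<star> coord t) $ l = (\<Sum>m\<in>UNIV. \<pi> (axis l 1) $ m * hcomul sweedler m s t)" for l
  proof -
    have "hcomulv A (axis l 1) $ (i,j) = c l i j" for i j
      by (simp add: hcomulv_def)
    then have "tmap \<pi> \<pi> (hcomulv A (axis l 1)) $ (s,t) = (coord s \<star> coord t) $ l"
      by (simp add: tmap_def tens_def convolution_def coord_def mult_ac)
    moreover have "tmap \<pi> \<pi> (hcomulv A (axis l 1)) = hcomulv sweedler (\<pi> (axis l 1))"
      using hopf by (simp add: hopf_map_def)
    ultimately show ?thesis by (simp add: hcomulv_def)
  qed
  then show ?thesis by (simp add: vec_eq_iff)
qed

lemma convolution_coord_table:
  "coord S1 \<star> coord S1 = coord S1" "coord S1 \<star> coord Sg = 0"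
  "coord Sg \<star> coord S1 = 0" "coord Sg \<star> coord Sg = coord Sg"
  "coord Sx \<star> coord S1 = coord Sx" "coord Sg \<star> coord Sx = coord Sx"
  "coord S1 \<star> coord Sx = 0" "coord Sx \<star> coord Sg = 0"
  "coord S1 \<star> coord Sgx = coord Sgx" "coord Sgx \<star> coord Sg = coord Sgx"
  "coord Sgx \<star> coord S1 = 0" "coord Sg \<star> coord Sgx = 0"
  "coord Sx \<star> coord Sgx = 0" "coord Sgx \<star> coord Sx = 0"
  by (simp_all add: convolution_coord vec_eq_iff sweedler_def UNIV_sw)

lemma counit_vec_eq_coord: "counit_vec = coord S1 + coord Sg"
proof -
  have "hcounitv sweedler (\<pi> (axis l 1)) = hcounitv A (axis l 1)" for l
    using hopf by (simp add: hopf_map_def)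
  then show ?thesis
    by (simp add: vec_eq_iff counit_vec_def coord_def hcounitv_def sweedler_def UNIV_sw)
qed

lemma right_coinvI:
  assumes "r \<in> D" "lhit (coord S1) r = r" "lhit (coord Sg) r = 0"
    "lhit (coord Sx) r = 0" "lhit (coord Sgx) r = 0"
  shows "r \<in> right_coinv A sweedler \<pi> D"
proof -
  have "tmap id \<pi> (hcomulv A r) $ (i,s)
      = (\<Sum>i'\<in>UNIV. axis i' 1 $ i * (\<Sum>j\<in>UNIV. hcomulv A r $ (i',j) * coord s $ j))" for i s
    by (simp add: tmap_def tens_def sum_distrib_left mult_ac)
  then have "tmap id \<pi> (hcomulv A r) $ (i,s) = lhit (coord s) r $ i" for i s
    by (simp add: contract_right_def lhit_eq_contract)
  then have "tmap id \<pi> (hcomulv A r) $ (i,s) = tens r (honev sweedler) $ (i,s)" for i s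
    by (cases s) (simp_all add: assms tens_def honev_def sweedler_def)
  then show ?thesis using assms(1) by (auto simp: right_coinv_def vec_eq_iff)
qed

lemma left_coinvI:
  assumes "r \<in> D" "rhit (coord S1) r = r" "rhit (coord Sg) r = 0"
    "rhit (coord Sx) r = 0" "rhit (coord Sgx) r = 0"
  shows "r \<in> left_coinv A sweedler \<pi> D"
proof -
  have "tmap \<pi> id (hcomulv A r) $ (s,j) = rhit (coord s) r $ j" for j s
    by (simp add: tmap_def tens_def sum_distrib_left mult_ac contract_left_def rhit_eq_contract)
  then have "tmap \<pi> id (hcomulv A r) $ (s,j) = tens (honev sweedler) r $ (s,j)" for j s
    by (cases s) (simp_all add: assms tens_def honev_def sweedler_def)
  then show ?thesis using assms(1) by (auto simp: left_coinv_def vec_eq_iff)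
qed

text \<open>Otherwise \<open>D\<close> would lie in the subalgebra \<open>\<pi>\<^sup>-\<^sup>1(span {1, g})\<close>.\<close>

lemma coord_nilpotent_nonvanishing:
  assumes "generates_alg A D" and "surj \<pi>"
  shows "\<exists>d\<in>D. pairing (coord Sx) d \<noteq> 0 \<or> pairing (coord Sgx) d \<noteq> 0"
proof (rule ccontr)
  assume vanish: "\<not> ?thesis"
  let ?S = "{h. \<pi> h $ Sx = 0 \<and> \<pi> h $ Sgx = 0}"
  have "vec.subspace ?S"
    by (rule vec.subspaceI)
      (simp_all add: vec.linear_add[OF linear_\<pi>] vec.linear_scale[OF linear_\<pi>] vec.linear_0[OF linear_\<pi>])
  moreover have "honev A \<in> ?S"
    using hopf by (simp add: hopf_map_def honev_def sweedler_def)
  moreover have "hmulv A x y \<in> ?S" if "x \<in> ?S" "y \<in> ?S" for x y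
  proof -
    have "\<pi> (hmulv A x y) = hmulv sweedler (\<pi> x) (\<pi> y)"
      using hopf by (simp add: hopf_map_def)
    then show ?thesis using that by (simp add: hmulv_def sweedler_def UNIV_sw)
  qed
  ultimately have "subalg A ?S" by (simp add: subalg_def)
  moreover have "D \<subseteq> ?S" using vanish by (auto simp: pairing_coord)
  ultimately have "?S = UNIV" using assms(1) by (simp add: generates_alg_def)
  moreover obtain h where "\<pi> h = axis Sx 1" using assms(2) by (metis surjD)
  ultimately show False by (metis (mono_tags, lifting) UNIV_I axis_nth mem_Collect_eq zero_neq_one)
qed

end

locale simple_sweedler_setting = sweedler_quotient A \<pi>
  for A :: "('b::finite, 'k::field) hopf_sc" and \<pi> +
  fixes D :: "('k^'b) set"
  assumes subcoalg: "subcoalg A D"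
    and simple: "\<And>E. subcoalg A E \<Longrightarrow> E \<subseteq> D \<Longrightarrow> E = {0} \<or> E = D"
    and dim_D: "vec.dim D = 4"
    and nilpotent_nonvanishing: "\<exists>d\<in>D. pairing (coord Sx) d \<noteq> 0 \<or> pairing (coord Sgx) d \<noteq> 0"
begin

abbreviation "e1 \<equiv> coord S1"
abbreviation "eg \<equiv> coord Sg"
abbreviation "ex \<equiv> coord Sx"
abbreviation "egx \<equiv> coord Sgx"

lemmas hit_simps = rhit_lhit_commute lhit_lhit rhit_rhit convolution_assoc convolution_coord_table

lemma subspace_D: "vec.subspace D"
  using subcoalg by (simp add: subcoalg_def)

lemma lhit_mem: "d \<in> D \<Longrightarrow> lhit w d \<in> D"
  by (rule subcoalg_lhit_mem[OF subcoalg])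

lemma rhit_mem: "d \<in> D \<Longrightarrow> rhit w d \<in> D"
  by (rule subcoalg_rhit_mem[OF subcoalg])

lemma coord_1_nonvanishing: "\<exists>d\<in>D. pairing e1 d \<noteq> 0"
proof (rule ccontr)
  assume "\<not> ?thesis"
  then have e1_zero: "agree_on D e1 0" by (simp add: agree_on_def)
  have "pairing ex d = 0 \<and> pairing egx d = 0" if d: "d \<in> D" for d
  proof
    have "pairing ex d = pairing ex (lhit e1 d)" by (simp add: pairing_lhit hit_simps)
    also have "\<dots> = 0" using subcoalg_lhit_cong[OF subcoalg e1_zero d] by simp
    finally show "pairing ex d = 0" .
    have "pairing egx d = pairing e1 (lhit egx d)" by (simp add: pairing_lhit hit_simps)
    also have "\<dots> = 0" using e1_zero lhit_mem[OF d] by (simp add: agree_on_def)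
    finally show "pairing egx d = 0" .
  qed
  with nilpotent_nonvanishing show False by blast
qed

lemma coord_g_nonvanishing: "\<exists>d\<in>D. pairing eg d \<noteq> 0"
proof (rule ccontr)
  assume "\<not> ?thesis"
  then have eg_zero: "agree_on D eg 0" by (simp add: agree_on_def)
  have "pairing ex d = 0 \<and> pairing egx d = 0" if d: "d \<in> D" for d
  proof
    have "pairing ex d = pairing eg (lhit ex d)" by (simp add: pairing_lhit hit_simps)
    also have "\<dots> = 0" using eg_zero lhit_mem[OF d] by (simp add: agree_on_def)
    finally show "pairing ex d = 0" .
    have "pairing egx d = pairing egx (lhit eg d)" by (simp add: pairing_lhit hit_simps)
    also have "\<dots> = 0" using subcoalg_lhit_cong[OF subcoalg eg_zero d] by simp
    finally show "pairing egx d = 0" .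
  qed
  with nilpotent_nonvanishing show False by blast
qed

lemma lhit_image_subspace: "vec.subspace (lhit p ` D)"
proof (rule vec.subspaceI)
  show "0 \<in> lhit p ` D"
    using vec.subspace_0[OF subspace_D] by (metis hit_zero(2) image_eqI)
  show "x + y \<in> lhit p ` D" if "x \<in> lhit p ` D" "y \<in> lhit p ` D" for x y
    using that vec.subspace_add[OF subspace_D] by (auto simp: lhit_add_right[symmetric])
  show "k *s x \<in> lhit p ` D" if "x \<in> lhit p ` D" for k x
    using that vec.subspace_scale[OF subspace_D] by (auto simp: lhit_scale_right[symmetric])
qed

text \<open>If the block \<open>p \<rightharpoonup> D \<leftharpoonup> q\<close> vanishes, then \<open>q \<rightharpoonup> v \<rightharpoonup> p \<rightharpoonup> D = 0\<close> for every
\<open>v\<close>, so \<open>p \<rightharpoonup> D\<close> is stable under both hits.\<close>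

lemma lhit_image_subcoalg:
  assumes p_idem: "p \<star> p = p" and q_p: "q \<star> p = 0" and split: "counit_vec = p + q"
    and block_zero: "\<And>y. y \<in> D \<Longrightarrow> rhit q (lhit p y) = 0"
  shows "subcoalg A (lhit p ` D)"
proof (rule subcoalg_if_hit_stable[OF lhit_image_subspace])
  fix w v assume "w \<in> lhit p ` D"
  then obtain d where d: "d \<in> D" "w = lhit p d" by blast
  have "agree_on D (q \<star> v \<star> p) 0"
    using block_zero by (simp add: agree_on_def pairing_rhit_lhit[symmetric])
  then have "lhit q (lhit v w) = 0"
    using subcoalg_lhit_cong[OF subcoalg _ d(1)] d(2) by (simp add: lhit_lhit convolution_assoc)
  then have "lhit v w = lhit p (lhit v w)"
    using lhit_counit[of "lhit v w"] by (simp add: split lhit_add_left)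
  then show "lhit v w \<in> lhit p ` D \<and> rhit v w \<in> lhit p ` D"
    using d lhit_mem rhit_mem by (auto simp: rhit_lhit_commute)
qed

lemma mixed_block_nonzero:
  assumes "p \<star> p = p" "q \<star> q = q" "p \<star> q = 0" "q \<star> p = 0" "counit_vec = p + q"
    and p_nonvanishing: "dp \<in> D" "pairing p dp \<noteq> 0"
    and q_nonvanishing: "dq \<in> D" "pairing q dq \<noteq> 0"
  shows "\<exists>y\<in>D. rhit q (lhit p y) \<noteq> 0"
proof (rule ccontr)
  assume "\<not> ?thesis"
  then have "subcoalg A (lhit p ` D)"
    using lhit_image_subcoalg assms(1,4,5) by blast
  moreover have "lhit p ` D \<subseteq> D" using lhit_mem by blast
  ultimately have "lhit p ` D = {0} \<or> lhit p ` D = D" using simple by blast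
  moreover have "lhit p dp \<noteq> 0" using p_nonvanishing pairing_counit_lhit[of p dp] by auto
  then have "lhit p ` D \<noteq> {0}" using p_nonvanishing by blast
  moreover have "lhit q dq \<notin> lhit p ` D"
  proof
    assume "lhit q dq \<in> lhit p ` D"
    then obtain y where "lhit q dq = lhit p y" by blast
    then have "lhit q dq = lhit q (lhit p y)" by (metis lhit_lhit assms(2))
    also have "\<dots> = 0" by (simp add: lhit_lhit assms(4))
    finally show False using q_nonvanishing pairing_counit_lhit[of q dq] by auto
  qed
  then have "lhit p ` D \<noteq> D" using q_nonvanishing lhit_mem by blast
  ultimately show False by blast
qed

lemma mixed_blocks_nonzero:
  "\<exists>y\<in>D. rhit eg (lhit e1 y) \<noteq> 0" "\<exists>y\<in>D. rhit e1 (lhit eg y) \<noteq> 0"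
  using mixed_block_nonzero[of e1 eg] mixed_block_nonzero[of eg e1]
    coord_1_nonvanishing coord_g_nonvanishing counit_vec_eq_coord
  by (auto simp: convolution_coord_table add.commute)

lemma diagonal_block_nonzero:
  assumes "d \<in> D" "pairing (coord s) d \<noteq> 0" "coord s \<star> coord s = coord s"
  shows "rhit (coord s) (lhit (coord s) d) \<noteq> 0"
  using assms pairing_rhit_lhit[of "coord s" "coord s" "coord s" d] by auto

lemma corner_block_rank_one:
  assumes y: "y \<in> D" "rhit eg (lhit e1 y) \<noteq> 0" and z: "z \<in> D"
  shows "\<exists>k. rhit eg (lhit e1 z) = k *s rhit eg (lhit e1 y)"
proof (rule ccontr)
  obtain d1 where d1: "d1 \<in> D" "pairing e1 d1 \<noteq> 0" using coord_1_nonvanishing by blast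
  obtain dg where dg: "dg \<in> D" "pairing eg dg \<noteq> 0" using coord_g_nonvanishing by blast
  obtain y' where y': "y' \<in> D" "rhit e1 (lhit eg y') \<noteq> 0" using mixed_blocks_nonzero(2) by blast
  define b11 where "b11 = rhit e1 (lhit e1 d1)"
  define bgg where "bgg = rhit eg (lhit eg dg)"
  define b1g where "b1g = rhit e1 (lhit eg y')"
  define bg1 where "bg1 = rhit eg (lhit e1 y)"
  define z' where "z' = rhit eg (lhit e1 z)"
  have nonzero: "b11 \<noteq> 0" "bgg \<noteq> 0" "b1g \<noteq> 0" "bg1 \<noteq> 0"
    using diagonal_block_nonzero[OF d1] diagonal_block_nonzero[OF dg] y y'
    by (simp_all add: b11_def bgg_def b1g_def bg1_def convolution_coord_table)
  have mem: "b11 \<in> D" "bgg \<in> D" "b1g \<in> D" "bg1 \<in> D" "z' \<in> D"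
    using d1 dg y y' z lhit_mem rhit_mem by (simp_all add: b11_def bgg_def b1g_def bg1_def z'_def)
  assume "\<nexists>k. rhit eg (lhit e1 z) = k *s rhit eg (lhit e1 y)"
  then have "z' \<notin> vec.span {bg1}" by (auto simp: vec.span_singleton z'_def bg1_def)
  then have I2: "vec.independent {z', bg1} \<and> card {z', bg1} = 2"
    using independent_insert_card[of "{bg1}" z'] independent_singleton_card[OF nonzero(4)] by simp
  have "b11 \<notin> vec.span {z', bg1}"
    by (rule not_in_span_if_killed[of "rhit e1"], simp add: rhit_add_right, simp add: rhit_scale_right)
      (use nonzero in \<open>auto simp: b11_def z'_def bg1_def hit_simps\<close>)
  then have I3: "vec.independent {b11, z', bg1} \<and> card {b11, z', bg1} = 3"
    using independent_insert_card[of "{z', bg1}" b11] I2 by simp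
  have "b1g \<notin> vec.span {b11, z', bg1}"
    by (rule not_in_span_if_killed[of "lhit eg"], simp add: lhit_add_right, simp add: lhit_scale_right)
      (use nonzero in \<open>auto simp: b11_def z'_def bg1_def b1g_def hit_simps\<close>)
  then have I4: "vec.independent {b1g, b11, z', bg1} \<and> card {b1g, b11, z', bg1} = 4"
    using independent_insert_card[of "{b11, z', bg1}" b1g] I3 by simp
  have "bgg \<notin> vec.span {b1g, b11, z', bg1}"
    by (rule not_in_span_if_killed[of "\<lambda>h. rhit eg (lhit eg h)"],
        simp add: lhit_add_right rhit_add_right, simp add: lhit_scale_right rhit_scale_right)
      (use nonzero in \<open>auto simp: b11_def z'_def bg1_def b1g_def bgg_def hit_simps\<close>)
  then have I5: "vec.independent {bgg, b1g, b11, z', bg1} \<and> card {bgg, b1g, b11, z', bg1} = 5"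
    using independent_insert_card[of "{b1g, b11, z', bg1}" bgg] I4 by simp
  have "card {bgg, b1g, b11, z', bg1} \<le> vec.dim D"
    by (rule vec.independent_card_le_dim) (use I5 mem in auto)
  with I5 dim_D show False by simp
qed

lemma corner_spanned_by_coord_x:
  assumes "\<not> agree_on D ex 0"
  obtains \<kappa> where "\<And>w. agree_on D (eg \<star> w \<star> e1) (\<kappa> w *s ex)"
proof -
  obtain y where y: "y \<in> D" "rhit eg (lhit e1 y) \<noteq> 0" using mixed_blocks_nonzero(1) by blast
  define b where "b = rhit eg (lhit e1 y)"
  have factor: "pairing w (rhit eg (lhit e1 d)) = k * pairing w b"
    if "rhit eg (lhit e1 d) = k *s b" for w d k
    using that by (simp add: pairing_scale_right)
  have ex_pairing: "\<exists>k. pairing ex d = k * pairing ex b \<and> pairing (eg \<star> w \<star> e1) d = k * pairing w b"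
    if "d \<in> D" for d w
  proof -
    obtain k where k: "rhit eg (lhit e1 d) = k *s b"
      using corner_block_rank_one[OF y \<open>d \<in> D\<close>] by (auto simp: b_def)
    have "pairing ex d = pairing (eg \<star> ex \<star> e1) d" by (simp add: convolution_coord_table)
    then show ?thesis using factor[OF k] by (auto simp: pairing_rhit_lhit)
  qed
  have "pairing ex b \<noteq> 0"
    using assms ex_pairing[where w = 0] by (auto simp: agree_on_def)
  have "agree_on D (eg \<star> w \<star> e1) ((pairing w b / pairing ex b) *s ex)" for w
    unfolding agree_on_def
  proof
    fix d assume "d \<in> D"
    then obtain k where "pairing ex d = k * pairing ex b" "pairing (eg \<star> w \<star> e1) d = k * pairing w b"
      using ex_pairing by blast
    with \<open>pairing ex b \<noteq> 0\<close> show "pairing (eg \<star> w \<star> e1) d = pairing ((pairing w b / pairing ex b) *s ex) d"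
      by (simp add: pairing_scale_left)
  qed
  then show ?thesis by (rule that)
qed

definition gx_annihilated :: "('k^'b) set" where
  "gx_annihilated = {d \<in> D. \<forall>u v. pairing egx (rhit u (lhit v d)) = 0}"

lemma subcoalg_gx_annihilated: "subcoalg A gx_annihilated"
proof (rule subcoalg_if_hit_stable)
  show "vec.subspace gx_annihilated"
    unfolding gx_annihilated_def
    by (rule vec.subspaceI)
      (use vec.subspace_0[OF subspace_D] vec.subspace_add[OF subspace_D] vec.subspace_scale[OF subspace_D]
        in \<open>simp_all add: lhit_add_right rhit_add_right pairing_add_right
          lhit_scale_right rhit_scale_right pairing_scale_right\<close>)
  fix w v assume "w \<in> gx_annihilated"
  moreover have "rhit u (lhit v' (rhit v w)) = rhit (v \<star> u) (lhit v' w)" for u v'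
    by (simp add: hit_simps)
  ultimately show "lhit v w \<in> gx_annihilated \<and> rhit v w \<in> gx_annihilated"
    using lhit_mem rhit_mem by (simp add: gx_annihilated_def lhit_lhit)
qed

text \<open>This uses \<open>e\<^sub>g\<^sub>x \<star> e\<^sub>g = e\<^sub>g\<^sub>x\<close> and \<open>e\<^sub>g\<^sub>x \<star> e\<^sub>x = 0\<close>.\<close>

lemma diagonal_block_gx_annihilated:
  assumes corner: "\<And>w. agree_on D (eg \<star> w \<star> e1) (\<kappa> w *s ex)" and d: "d \<in> D"
  shows "rhit e1 (lhit e1 d) \<in> gx_annihilated"
proof -
  have "pairing egx (rhit u (lhit v (rhit e1 (lhit e1 d)))) = 0" for u v
  proof -
    define Y where "Y = e1 \<star> u \<star> egx"
    have "Y \<star> eg = Y" by (simp add: Y_def convolution_assoc convolution_coord_table)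
    have "pairing egx (rhit u (lhit v (rhit e1 (lhit e1 d)))) = pairing (Y \<star> (v \<star> e1)) d"
      by (simp add: Y_def hit_simps pairing_lhit pairing_rhit)
    also have "\<dots> = pairing (Y \<star> (eg \<star> v \<star> e1)) d"
      by (metis \<open>Y \<star> eg = Y\<close> convolution_assoc)
    also have "\<dots> = pairing (Y \<star> (\<kappa> v *s ex)) d"
      using agree_on_convolution_right[OF subcoalg corner] d by (simp add: agree_on_def)
    also have "\<dots> = 0"
      by (simp add: convolution_scale_right Y_def convolution_assoc convolution_coord_table)
    finally show ?thesis .
  qed
  then show ?thesis using d lhit_mem rhit_mem by (simp add: gx_annihilated_def)
qed

lemma coord_x_or_coord_gx_vanishes: "agree_on D ex 0 \<or> agree_on D egx 0"
proof (rule ccontr)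
  assume "\<not> ?thesis"
  then obtain \<kappa> where corner: "\<And>w. agree_on D (eg \<star> w \<star> e1) (\<kappa> w *s ex)"
    and egx_nonvanishing: "\<not> agree_on D egx 0"
    using corner_spanned_by_coord_x by blast
  obtain d1 where d1: "d1 \<in> D" "pairing e1 d1 \<noteq> 0" using coord_1_nonvanishing by blast
  have "rhit e1 (lhit e1 d1) \<in> gx_annihilated"
    by (rule diagonal_block_gx_annihilated[OF corner d1(1)])
  moreover have "rhit e1 (lhit e1 d1) \<noteq> 0"
    using diagonal_block_nonzero[OF d1] by (simp add: convolution_coord_table)
  moreover have "gx_annihilated \<noteq> D"
  proof
    assume "gx_annihilated = D"
    have "pairing egx d = 0" if "d \<in> D" for d
    proof -
      have "\<forall>u v. pairing egx (rhit u (lhit v d)) = 0"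
        using that \<open>gx_annihilated = D\<close> unfolding gx_annihilated_def by blast
      then show ?thesis by (metis lhit_counit rhit_counit)
    qed
    with egx_nonvanishing show False by (simp add: agree_on_def)
  qed
  ultimately show False
    using simple[OF subcoalg_gx_annihilated] by (auto simp: gx_annihilated_def)
qed

lemma right_coinv_dim_ge_2:
  assumes ex_zero: "agree_on D ex 0"
  shows "2 \<le> vec.dim (right_coinv A sweedler \<pi> D)"
proof -
  have coinv: "lhit e1 z \<in> right_coinv A sweedler \<pi> D" if "z \<in> D" for z
  proof (rule right_coinvI)
    show "lhit ex (lhit e1 z) = 0"
      using subcoalg_lhit_cong[OF subcoalg ex_zero] that lhit_mem by simp
  qed (use that lhit_mem in \<open>simp_all add: lhit_lhit convolution_coord_table\<close>)
  obtain d1 where d1: "d1 \<in> D" "pairing e1 d1 \<noteq> 0" using coord_1_nonvanishing by blast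
  obtain y where y: "y \<in> D" "rhit eg (lhit e1 y) \<noteq> 0" using mixed_blocks_nonzero(1) by blast
  let ?p = "lhit e1 (rhit e1 d1)" and ?q = "lhit e1 (rhit eg y)"
  have "?p \<noteq> 0" "?q \<noteq> 0"
    using diagonal_block_nonzero[OF d1] y by (simp_all add: convolution_coord_table rhit_lhit_commute)
  then have "vec.independent {?p, ?q} \<and> card {?p, ?q} = 2"
    by (intro independent_pair_by_projection[of "rhit e1"])
      (simp_all add: rhit_add_right rhit_scale_right hit_simps)
  moreover have "{?p, ?q} \<subseteq> right_coinv A sweedler \<pi> D" using coinv d1 y rhit_mem by auto
  ultimately show ?thesis by (rule two_le_dim_if_independent_pair)
qed

lemma left_coinv_dim_ge_2:
  assumes egx_zero: "agree_on D egx 0"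
  shows "2 \<le> vec.dim (left_coinv A sweedler \<pi> D)"
proof -
  have coinv: "rhit e1 z \<in> left_coinv A sweedler \<pi> D" if "z \<in> D" for z
  proof (rule left_coinvI)
    show "rhit egx (rhit e1 z) = 0"
      using subcoalg_rhit_cong[OF subcoalg egx_zero] that rhit_mem by simp
  qed (use that rhit_mem in \<open>simp_all add: rhit_rhit convolution_coord_table\<close>)
  obtain d1 where d1: "d1 \<in> D" "pairing e1 d1 \<noteq> 0" using coord_1_nonvanishing by blast
  obtain y where y: "y \<in> D" "rhit e1 (lhit eg y) \<noteq> 0" using mixed_blocks_nonzero(2) by blast
  let ?p = "rhit e1 (lhit e1 d1)" and ?q = "rhit e1 (lhit eg y)"
  have "?p \<noteq> 0" "?q \<noteq> 0"
    using diagonal_block_nonzero[OF d1] y by (simp_all add: convolution_coord_table)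
  then have "vec.independent {?p, ?q} \<and> card {?p, ?q} = 2"
    by (intro independent_pair_by_projection[of "lhit e1"])
      (simp_all add: lhit_add_right lhit_scale_right hit_simps)
  moreover have "{?p, ?q} \<subseteq> left_coinv A sweedler \<pi> D" using coinv d1 y lhit_mem by auto
  ultimately show ?thesis by (rule two_le_dim_if_independent_pair)
qed

end

theorem lemma2p12:
  fixes A :: "('b::finite, 'k::field_char_0) hopf_sc"
    and D :: "('k^'b) set"
    and \<pi> :: "'k^'b \<Rightarrow> 'k^sw"
  assumes "alg_closed_field TYPE('k)"
    and "is_hopf A"
    and "simple_subcoalg A D"
    and "vec.dim D = 4"
    and "generates_alg A D"
    and "hopf_map A sweedler \<pi>"
    and "surj \<pi>"
  shows "vec.dim (left_coinv A sweedler \<pi> D) \<ge> 2 \<or> vec.dim (right_coinv A sweedler \<pi> D) \<ge> 2"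
proof -
  interpret sweedler_quotient A \<pi>
    by unfold_locales (use assms(2,6) in \<open>simp_all add: is_hopf_def Let_def\<close>)
  interpret simple_sweedler_setting A \<pi> D
    by unfold_locales
      (use assms(3,4) coord_nilpotent_nonvanishing[OF assms(5,7)] in \<open>auto simp: simple_subcoalg_def\<close>)
  show ?thesis
    using coord_x_or_coord_gx_vanishes left_coinv_dim_ge_2 right_coinv_dim_ge_2 by blast
qed

end
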